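(* Let $G$ be a group with finite generating set $\Sigma$, and fix a total order on $\Sigma\cup\Sigma^{-1}$. If $G$ satisfies the shortlex falsification by fellow traveller property (SL-FFTP) with respect to $\Sigma$ (and the fixed order), then $G$ has a finite number of $\mathrm{SL}$-cones, i.e. the set $\{\mathrm{C}_{\mathrm{SL}}(g): g\in G\}$ is finite.
   Context: $\Sigma\cup\Sigma^{-1}$ is regarded as a finite subset of $G$, and $(\Sigma\cup\Sigma^{-1})^*$ is the set of finite words over it; $|w|$ is the length of a word $w$, and $w=_Gv$ means that $w$ and $v$ represent the same element of $G$. Shortlex order. For words $w_1,w_2$ over a totally ordered alphabet $(S,<)$: $w_1<_{\mathrm{lex}}w_2$ iff $w_1$ is a strict prefix of $w_2$ or, in the first position where they differ, the letter of $w_1$ is smaller than that of $w_2$; $w_1<_{\mathrm{SL}}w_2$ iff $|w_1|<|w_2|$, or $|w_1|=|w_2|$ and $w_1<_{\mathrm{lex}}w_2$. The order $<_{\mathrm{SL}}$ is a well-ordering. For $g\in G$, $\mathrm{SL}(g)$ is the $<_{\mathrm{SL}}$-minimal word in $(\Sigma\cup\Sigma^{-1})^*$ representing $g$, and $\mathrm{SL}_G=\{\mathrm{SL}(g):g\in G\}$. SL-cones. For $g\in G$, the $\mathrm{SL}$-cone of $g$ is $\mathrm{C}_{\mathrm{SL}}(g)=\{w\in(\Sigma\cup\Sigma^{-1})^*:\ \mathrm{SL}(g)w\in\mathrm{SL}_G\}$, where $\mathrm{SL}(g)w$ is the concatenation of words. Fellow travelling. A word $w=s_1\cdots s_n$ determines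 the path in the Cayley graph of $G$ with respect to $\Sigma$ with vertices $v_0=1_G$, $v_i=s_1\cdots s_i$. For $K\ge 0$, two paths with vertex sequences $v_0,\dots,v_n$ and $u_0,\dots,u_m$ asynchronously $K$-fellow travel if there are non-decreasing maps $f:\{0,\dots,n\}\to\{0,\dots,m\}$ and $g:\{0,\dots,m\}\to\{0,\dots,n\}$ such that $d(v_i,u_{f(i)})\le K$ for all $i$ and $d(u_j,v_{g(j)})\le K$ for all $j$, where $d$ is the graph distance. Two words asynchronously $K$-fellow travel if their paths starting at $1_G$ do. SL-FFTP. $G$ has SL-FFTP with respect to $\Sigma$ (and the order $<$ on $\Sigma\cup\Sigma^{-1}$) if there is a constant $K\ge0$ such that for every word $w\in(\Sigma\cup\Sigma^{-1})^*$ with $w\notin\mathrm{SL}_G$ there is a word $v\in(\Sigma\cup\Sigma^{-1})^*$ that asynchronously $K$-fellow travels with $w$ and satisfies $w=_Gv$ and $v<_{\mathrm{SL}}w$. *)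

theory Defs
  imports Complex_Main "HOL-Algebra.Generated_Groups"
begin

definition letters :: "('a, 'b) monoid_scheme \<Rightarrow> 'a set \<Rightarrow> 'a set" where
  "letters G \<Sigma> = \<Sigma> \<union> m_inv G ` \<Sigma>"

text \<open>Words over \<open>letters G \<Sigma>\<close> are the elements of \<open>lists (letters G \<Sigma>)\<close>; they are
  not assumed to be reduced.\<close>

definition word_val :: "('a, 'b) monoid_scheme \<Rightarrow> 'a list \<Rightarrow> 'a" where
  "word_val G w = foldr (\<otimes>\<^bsub>G\<^esub>) w \<one>\<^bsub>G\<^esub>"

text \<open>The order on the letters is given as a strict order \<open>r\<close>, so that \<open>lenlex r\<close> is the strict
  shortlex order.  The definite description below is meaningful when \<open>\<Sigma>\<close> is a finite
  generating set of \<open>G\<close>, \<open>r\<close> is a strict linear order on the letters and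
  \<open>g \<in> carrier G\<close>.\<close>

definition SL :: "('a, 'b) monoid_scheme \<Rightarrow> 'a set \<Rightarrow> ('a \<times> 'a) set \<Rightarrow> 'a \<Rightarrow> 'a list" where
  "SL G \<Sigma> r g =
    (THE w. w \<in> lists (letters G \<Sigma>) \<and> word_val G w = g \<and>
       (\<forall>v \<in> lists (letters G \<Sigma>). word_val G v = g \<longrightarrow> (v, w) \<notin> lenlex r))"

definition SL_words :: "('a, 'b) monoid_scheme \<Rightarrow> 'a set \<Rightarrow> ('a \<times> 'a) set \<Rightarrow> 'a list set" where
  "SL_words G \<Sigma> r = SL G \<Sigma> r ` carrier G"

definition SL_cone :: "('a, 'b) monoid_scheme \<Rightarrow> 'a set \<Rightarrow> ('a \<times> 'a) set \<Rightarrow> 'a \<Rightarrow> 'a list set" where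
  "SL_cone G \<Sigma> r g = {w \<in> lists (letters G \<Sigma>). SL G \<Sigma> r g @ w \<in> SL_words G \<Sigma> r}"

text \<open>The undirected Cayley graph, as a symmetric relation.\<close>

definition cayley_edges :: "('a, 'b) monoid_scheme \<Rightarrow> 'a set \<Rightarrow> ('a \<times> 'a) set" where
  "cayley_edges G \<Sigma> =
    {(g, h). g \<in> carrier G \<and> h \<in> carrier G \<and> (\<exists>s \<in> \<Sigma>. h = g \<otimes>\<^bsub>G\<^esub> s \<or> g = h \<otimes>\<^bsub>G\<^esub> s)}"

text \<open>The length of a shortest edge path.  Some edge path exists between any two vertices when
  \<open>\<Sigma>\<close> generates \<open>G\<close>.\<close>

definition cayley_dist :: "('a, 'b) monoid_scheme \<Rightarrow> 'a set \<Rightarrow> 'a \<Rightarrow> 'a \<Rightarrow> nat" where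
  "cayley_dist G \<Sigma> g h = (LEAST n. (g, h) \<in> cayley_edges G \<Sigma> ^^ n)"

text \<open>The vertex sequence of the path from the identity labelled by \<open>w\<close>, with
  \<open>length w + 1\<close> entries.\<close>

definition word_path :: "('a, 'b) monoid_scheme \<Rightarrow> 'a list \<Rightarrow> 'a list" where
  "word_path G w = map (\<lambda>i. word_val G (take i w)) [0..<Suc (length w)]"

definition paths_async_fellow_travel ::
    "('a, 'b) monoid_scheme \<Rightarrow> 'a set \<Rightarrow> real \<Rightarrow> 'a list \<Rightarrow> 'a list \<Rightarrow> bool" where
  "paths_async_fellow_travel G \<Sigma> K p q \<longleftrightarrow>
    (\<exists>f g. f ` {..<length p} \<subseteq> {..<length q} \<and> mono_on {..<length p} f \<and>
           g ` {..<length q} \<subseteq> {..<length p} \<and> mono_on {..<length q} g \<and>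
           (\<forall>i < length p. real (cayley_dist G \<Sigma> (p ! i) (q ! f i)) \<le> K) \<and>
           (\<forall>j < length q. real (cayley_dist G \<Sigma> (q ! j) (p ! g j)) \<le> K))"

definition words_async_fellow_travel ::
    "('a, 'b) monoid_scheme \<Rightarrow> 'a set \<Rightarrow> real \<Rightarrow> 'a list \<Rightarrow> 'a list \<Rightarrow> bool" where
  "words_async_fellow_travel G \<Sigma> K w v \<longleftrightarrow>
    paths_async_fellow_travel G \<Sigma> K (word_path G w) (word_path G v)"

definition SL_FFTP :: "('a, 'b) monoid_scheme \<Rightarrow> 'a set \<Rightarrow> ('a \<times> 'a) set \<Rightarrow> bool" where
  "SL_FFTP G \<Sigma> r \<longleftrightarrow>
    (\<exists>K \<ge> 0. \<forall>w \<in> lists (letters G \<Sigma>). w \<notin> SL_words G \<Sigma> r \<longrightarrow>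
      (\<exists>v \<in> lists (letters G \<Sigma>). words_async_fellow_travel G \<Sigma> K w v \<and>
         word_val G w = word_val G v \<and> (v, w) \<in> lenlex r))"

end

theory Submission
  imports Defs
begin

text \<open>The cone of \<open>g\<close> is determined by how \<open>SL(g h)\<close> compares with \<open>SL(g)\<close>, for \<open>h\<close> in the ball
  of radius \<open>K\<close>.  If \<open>SL(g) u\<close> is not a shortlex word, a falsifying fellow traveller
  passes through a vertex \<open>g h\<close> of that ball around \<open>g\<close>, and its initial segment up to this vertex
  may be replaced by \<open>SL(g h)\<close>.  So \<open>u\<close> lies outside the cone iff some \<open>a\<close> with
  \<open>h a = u\<close> in \<open>G\<close> satisfies \<open>SL(g h) a < SL(g) u\<close>.  As the lengths of \<open>SL(g h)\<close> and
  \<open>SL(g)\<close> differ by at most \<open>K\<close>, only finitely many relations between \<open>a\<close> and \<open>u\<close> arise.\<close>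

section \<open>Shortlex comparison of two words under all pairs of continuations\<close>

definition shortlex_extensions :: "('a \<times> 'a) set \<Rightarrow> 'a list \<Rightarrow> 'a list \<Rightarrow> ('a list \<times> 'a list) set" where
  "shortlex_extensions r x y = {(a, b). (x @ a, y @ b) \<in> lenlex r}"

text \<open>The first difference already lies within \<open>x\<close> and \<open>y\<close>.
  Irreflexivity keeps equal letters from counting as a descent.\<close>

lemma lex_append_iff:
  assumes "irrefl r" "length x = length y" "x \<noteq> y" "length a = length b"
  shows "(x @ a, y @ b) \<in> lex r \<longleftrightarrow> (x, y) \<in> lex r"
  using assms(2,3)
proof (induction x y rule: list_induct2)
  case Nil
  then show ?case by simp
next
  case (Cons x xs y ys)
  then show ?case using assms(1,4) by (auto simp: irrefl_def)
qed

lemma total_on_lenlex: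
  assumes "total_on A r"
  shows "total_on (lists A) (lenlex r)"
proof (rule total_onI)
  have lex: "(x, y) \<in> lex r \<or> (y, x) \<in> lex r"
    if "length x = length y" "x \<in> lists A" "y \<in> lists A" "x \<noteq> y" for x y
    using that
  proof (induction x y rule: list_induct2)
    case Nil
    then show ?case by simp
  next
    case (Cons x xs y ys)
    then show ?case using assms by (auto simp: total_on_def)
  qed
  show "(x, y) \<in> lenlex r \<or> (y, x) \<in> lenlex r"
    if "x \<in> lists A" "y \<in> lists A" "x \<noteq> y" for x y
    using that lex[of x y] by (cases "length x" "length y" rule: linorder_cases)
      (auto simp: lenlex_conv)
qed

text \<open>Equal prefixes cancel. Distinct prefixes of equal length settle every lexicographic
  comparison, so what follows matters only through its length, and \<open>x\<close> and
  \<open>y\<close> decide just the tie.\<close>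

lemma shortlex_extensions_cases:
  assumes "irrefl r" "length x = length y"
  shows "shortlex_extensions r (x @ s) (y @ t) =
    (if x = y then shortlex_extensions r s t
     else if (x, y) \<in> lex r then {(a, b). length s + length a \<le> length t + length b}
     else {(a, b). length s + length a < length t + length b})"
  using assms lex_append_iff[OF assms]
  by (auto simp: shortlex_extensions_def) (auto simp: lenlex_conv)

lemma finite_shortlex_extensions:
  assumes "irrefl r" "finite A"
  shows "finite {shortlex_extensions r x y | x y.
    x \<in> lists A \<and> y \<in> lists A \<and> length x \<le> length y + K \<and> length y \<le> length x + K}"
proof -
  define W where "W = {s. set s \<subseteq> A \<and> length s \<le> K}"
  have W: "finite W"
    using assms(2) finite_lists_length_le unfolding W_def by blast
  let ?le = "\<lambda>(s, t). {(a :: 'a list, b :: 'a list). length s + length a \<le> length t + length b}"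
  let ?lt = "\<lambda>(s, t). {(a :: 'a list, b :: 'a list). length s + length a < length t + length b}"
  let ?F = "(\<lambda>(s, t). shortlex_extensions r s t) ` (W \<times> W) \<union> ?le ` (W \<times> W) \<union> ?lt ` (W \<times> W)"
  have "shortlex_extensions r x y \<in> ?F"
    if x: "x \<in> lists A" and y: "y \<in> lists A"
      and xy: "length x \<le> length y + K" "length y \<le> length x + K" for x y
  proof -
    \<comment> \<open>Cutting both words at the shorter length leaves one tail empty and the other
      of length at most \<open>K\<close>, hence finitely many pairs of tails.\<close>
    define n where "n = min (length x) (length y)"
    have st: "(drop n x, drop n y) \<in> W \<times> W"
      using x y xy by (auto simp: W_def n_def dest: in_set_dropD)
    have "length (take n x) = length (take n y)"
      by (simp add: n_def)
    from shortlex_extensions_cases[OF assms(1) this, of "drop n x" "drop n y"]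
    have "shortlex_extensions r x y \<in>
      {shortlex_extensions r (drop n x) (drop n y), ?le (drop n x, drop n y), ?lt (drop n x, drop n y)}"
      unfolding append_take_drop_id prod.case by (metis insertI1 insertI2)
    then show ?thesis
      using imageI[OF st, of "\<lambda>(s, t). shortlex_extensions r s t"] imageI[OF st, of ?le]
        imageI[OF st, of ?lt]
      by (auto simp only: prod.case)
  qed
  then have "{shortlex_extensions r x y | x y.
    x \<in> lists A \<and> y \<in> lists A \<and> length x \<le> length y + K \<and> length y \<le> length x + K} \<subseteq> ?F"
    by blast
  then show ?thesis
    by (rule finite_subset) (intro finite_UnI finite_imageI finite_cartesian_product W)
qed

section \<open>Words, their values and shortlex representatives\<close>

locale ordered_generators = group G for G (structure) +
  fixes \<Sigma> r
  assumes finite_gens: "finite \<Sigma>" and gens_closed: "\<Sigma> \<subseteq> carrier G"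
    and generates: "generate G \<Sigma> = carrier G"
    and r_letters: "r \<subseteq> letters G \<Sigma> \<times> letters G \<Sigma>"
    and linear: "strict_linear_order_on (letters G \<Sigma>) r"
begin

abbreviation words where "words \<equiv> lists (letters G \<Sigma>)"
abbreviation sl where "sl \<equiv> SL G \<Sigma> r"
abbreviation shortlex_less (infix \<open>\<prec>\<close> 50) where "v \<prec> w \<equiv> (v, w) \<in> lenlex r"

lemma finite_letters: "finite (letters G \<Sigma>)"
  using finite_gens by (simp add: letters_def)

lemma letters_closed: "letters G \<Sigma> \<subseteq> carrier G"
  using gens_closed by (auto simp: letters_def)

lemma word_val_Nil [simp]: "word_val G [] = \<one>"
  by (simp add: word_val_def)

lemma word_val_Cons [simp]: "word_val G (s # w) = s \<otimes> word_val G w"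
  by (simp add: word_val_def)

lemma word_val_closed [simp]: "w \<in> words \<Longrightarrow> word_val G w \<in> carrier G"
  by (induction w) (use letters_closed in auto)

lemma word_val_append:
  "v \<in> words \<Longrightarrow> w \<in> words \<Longrightarrow> word_val G (v @ w) = word_val G v \<otimes> word_val G w"
proof (induction v)
  case Nil
  then show ?case by simp
next
  case (Cons s v)
  then show ?case using letters_closed by (auto simp: m_assoc subset_iff)
qed

lemma irrefl_r: "irrefl r" and trans_r: "trans r" and total_r: "total_on (letters G \<Sigma>) r"
  using linear by (auto simp: strict_linear_order_on_def)

lemma trans_lenlex_r: "trans (lenlex r)"
  using trans_r by (rule lenlex_transI)

lemma wf_lenlex_r: "wf (lenlex r)"
proof -
  \<comment> \<open>For a finite relation acyclicity already gives well-foundedness, which passes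
    from letters to the shortlex order.\<close>
  have "finite r"
    using r_letters finite_letters by (meson finite_SigmaI finite_subset)
  moreover have "acyclic r"
    using irrefl_r trans_r by (simp add: acyclic_irrefl)
  ultimately show ?thesis
    by (intro wf_lenlex finite_acyclic_wf)
qed

lemma ex_word:
  assumes "g \<in> carrier G"
  shows "\<exists>w \<in> words. word_val G w = g"
proof -
  have "g \<in> generate G \<Sigma>"
    using assms generates by simp
  then show ?thesis
  proof (induction g)
    case one
    then show ?case by (intro bexI[of _ "[]"]) auto
  next
    case (incl h)
    then show ?case using gens_closed by (intro bexI[of _ "[h]"]) (auto simp: letters_def)
  next
    case (inv h)
    then show ?case using gens_closed by (intro bexI[of _ "[inv h]"]) (auto simp: letters_def)
  next
    case (eng h1 h2)
    then show ?case by (metis word_val_append append_in_lists_conv)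
  qed
qed

text \<open>This justifies the definite description in \<open>SL\<close>: a minimal word exists by
  well-foundedness, and it is unique because shortlex is total on words.\<close>

lemma sl_props:
  assumes "g \<in> carrier G"
  shows sl_words: "sl g \<in> words" and word_val_sl: "word_val G (sl g) = g"
    and sl_minimal: "\<And>v. v \<in> words \<Longrightarrow> word_val G v = g \<Longrightarrow> \<not> v \<prec> sl g"
proof -
  let ?Q = "{w \<in> words. word_val G w = g}"
  let ?P = "\<lambda>w. w \<in> words \<and> word_val G w = g \<and>
    (\<forall>v \<in> words. word_val G v = g \<longrightarrow> \<not> v \<prec> w)"
  obtain w0 where w0: "w0 \<in> ?Q"
    using ex_word[OF assms] by blast
  obtain w where w: "w \<in> ?Q" "\<And>v. v \<prec> w \<Longrightarrow> v \<notin> ?Q"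
    by (rule wfE_min[OF wf_lenlex_r w0]) blast
  have "w' = w" if "?P w'" for w'
    using that w total_on_lenlex[OF total_r] unfolding total_on_def by blast
  then have "\<exists>!w. ?P w"
    using w by blast
  from theI'[OF this] have "?P (sl g)"
    unfolding SL_def .
  then show "sl g \<in> words" "word_val G (sl g) = g"
    "\<And>v. v \<in> words \<Longrightarrow> word_val G v = g \<Longrightarrow> \<not> v \<prec> sl g"
    by blast+
qed

lemma sl_eq_or_less:
  assumes "w \<in> words"
  shows "sl (word_val G w) = w \<or> sl (word_val G w) \<prec> w"
  using assms sl_props[of "word_val G w"] total_on_lenlex[OF total_r]
  unfolding total_on_def by auto

text \<open>Serves to refute membership by exhibiting one smaller word with the same value.\<close>

lemma SL_words_iff:
  assumes "w \<in> words"
  shows "w \<in> SL_words G \<Sigma> r \<longleftrightarrow> (\<forall>v \<in> words. word_val G v = word_val G w \<longrightarrow> \<not> v \<prec> w)"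
proof
  assume "w \<in> SL_words G \<Sigma> r"
  then obtain g where g: "g \<in> carrier G" "w = sl g"
    by (auto simp: SL_words_def)
  show "\<forall>v \<in> words. word_val G v = word_val G w \<longrightarrow> \<not> v \<prec> w"
    unfolding g(2) word_val_sl[OF g(1)] using sl_minimal[OF g(1)] by blast
next
  assume *: "\<forall>v \<in> words. word_val G v = word_val G w \<longrightarrow> \<not> v \<prec> w"
  note g = word_val_closed[OF assms]
  have "sl (word_val G w) = w"
    using sl_eq_or_less[OF assms] * sl_words[OF g] word_val_sl[OF g] by blast
  then show "w \<in> SL_words G \<Sigma> r"
    unfolding SL_words_def using g by (metis imageI)
qed

lemma length_sl_le:
  assumes "w \<in> words"
  shows "length (sl (word_val G w)) \<le> length w"
  using sl_eq_or_less[OF assms] by (auto simp: lenlex_conv)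

lemma length_sl_mult_le:
  assumes "g \<in> carrier G" "w \<in> words"
  shows "length (sl (g \<otimes> word_val G w)) \<le> length (sl g) + length w"
  using length_sl_le[of "sl g @ w"] assms by (simp add: word_val_append sl_words word_val_sl)

section \<open>Inverses, Cayley distance, balls and their types\<close>

lemma letters_inv: "s \<in> letters G \<Sigma> \<Longrightarrow> inv s \<in> letters G \<Sigma>"
  using gens_closed by (auto simp: letters_def subset_iff)

text \<open>Reverse the word and invert its letters. The equal length makes the length bounds on a
  ball symmetric.\<close>

lemma ex_inverse_word:
  assumes "w \<in> words"
  shows "\<exists>w' \<in> words. length w' = length w \<and> word_val G w' = inv word_val G w"
  using assms
proof (induction w)
  case Nil
  then show ?case by auto
next
  case (Cons s w)
  then obtain w' where "w' \<in> words" "length w' = length w" "word_val G w' = inv word_val G w"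
    by auto
  moreover have "s \<in> carrier G"
    using Cons letters_closed by auto
  ultimately show ?case
    using Cons letters_inv[of s]
    by (intro bexI[of _ "w' @ [inv s]"]) (auto simp: word_val_append inv_mult_group)
qed

text \<open>Crossing an edge labelled \<open>s\<close> backwards is right multiplication by
  \<open>inv s\<close>, so edge paths are labelled by words over the letters.\<close>

lemma cayley_edge_iff:
  "(g, h) \<in> cayley_edges G \<Sigma> \<longleftrightarrow> g \<in> carrier G \<and> (\<exists>s \<in> letters G \<Sigma>. h = g \<otimes> s)"
proof -
  have "g = h \<otimes> s \<longleftrightarrow> h = g \<otimes> inv s" if "g \<in> carrier G" "h \<in> carrier G" "s \<in> \<Sigma>" for s
    using that gens_closed inv_solve_right[of h g s] by auto
  then show ?thesis
    using gens_closed unfolding cayley_edges_def letters_def by (auto 4 4 simp: subset_iff)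
qed

lemma cayley_relpow_iff:
  assumes "g \<in> carrier G"
  shows "(g, h) \<in> cayley_edges G \<Sigma> ^^ n \<longleftrightarrow>
    (\<exists>w \<in> words. length w = n \<and> h = g \<otimes> word_val G w)"
  using assms
proof (induction n arbitrary: g)
  case 0
  then show ?case by auto
next
  case (Suc n)
  have closed: "g \<otimes> s \<in> carrier G" if "s \<in> letters G \<Sigma>" for s
    using that Suc.prems letters_closed by auto
  \<comment> \<open>Commuting the relation power splits off the first edge instead of the last, in
    line with the head of a word.\<close>
  have "(g, h) \<in> cayley_edges G \<Sigma> ^^ Suc n \<longleftrightarrow>
      (\<exists>s \<in> letters G \<Sigma>. (g \<otimes> s, h) \<in> cayley_edges G \<Sigma> ^^ n)"
    unfolding relpow.simps(2) relpow_commute[symmetric]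
    using Suc.prems by (auto simp: relcomp_unfold cayley_edge_iff)
  also have "\<dots> \<longleftrightarrow> (\<exists>s \<in> letters G \<Sigma>. \<exists>w \<in> words. length w = n \<and> h = g \<otimes> s \<otimes> word_val G w)"
    using Suc.IH closed by auto
  also have "\<dots> \<longleftrightarrow> (\<exists>s \<in> letters G \<Sigma>. \<exists>w \<in> words. length w = n \<and> h = g \<otimes> word_val G (s # w))"
    using Suc.prems letters_closed by (auto simp: m_assoc subset_iff)
  also have "\<dots> \<longleftrightarrow> (\<exists>w \<in> words. length w = Suc n \<and> h = g \<otimes> word_val G w)"
    unfolding length_Suc_conv Bex_def by (metis Cons_in_lists_iff)
  finally show ?case .
qed

text \<open>A word for \<open>inv g \<otimes> h\<close> labels a path from \<open>g\<close> to
  \<open>h\<close>, so the \<open>LEAST\<close> in \<open>cayley_dist\<close> is attained.\<close>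

lemma cayley_dist_word:
  assumes "g \<in> carrier G" "h \<in> carrier G"
  shows "\<exists>w \<in> words. length w = cayley_dist G \<Sigma> g h \<and> h = g \<otimes> word_val G w"
proof -
  obtain w where "w \<in> words" "word_val G w = inv g \<otimes> h"
    using ex_word assms by (meson inv_closed m_closed)
  then have "(g, h) \<in> cayley_edges G \<Sigma> ^^ length w"
    using assms by (auto simp: cayley_relpow_iff m_assoc[symmetric] intro!: bexI[of _ w])
  then have "(g, h) \<in> cayley_edges G \<Sigma> ^^ cayley_dist G \<Sigma> g h"
    unfolding cayley_dist_def by (rule LeastI)
  then show ?thesis
    using assms by (simp add: cayley_relpow_iff)
qed

text \<open>The ball around the identity; left translation by \<open>g\<close> gives the ball around
  \<open>g\<close>. Describing it by words makes its finiteness immediate.\<close>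

definition ball_gens :: "nat \<Rightarrow> 'a set" where
  "ball_gens K = word_val G ` {w \<in> words. length w \<le> K}"

lemma finite_ball_gens: "finite (ball_gens K)"
  using finite_lists_length_le[OF finite_letters, of K]
  unfolding ball_gens_def lists_eq_set mem_Collect_eq by (rule finite_imageI)

lemma ball_gens_closed: "h \<in> ball_gens K \<Longrightarrow> h \<in> carrier G"
  unfolding ball_gens_def using word_val_closed by blast

text \<open>The second bound comes from returning from \<open>g \<otimes> h\<close> to
  \<open>g\<close> along an inverse word of length at most \<open>K\<close>.\<close>

lemma length_sl_ball:
  assumes "g \<in> carrier G" "h \<in> ball_gens K"
  shows "length (sl (g \<otimes> h)) \<le> length (sl g) + K" "length (sl g) \<le> length (sl (g \<otimes> h)) + K"
proof -
  obtain w where w: "w \<in> words" "length w \<le> K" "h = word_val G w"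
    using assms(2) by (auto simp: ball_gens_def)
  show "length (sl (g \<otimes> h)) \<le> length (sl g) + K"
    using length_sl_mult_le[OF assms(1) w(1)] w by simp
  obtain w' where w': "w' \<in> words" "length w' = length w" "word_val G w' = inv h"
    using ex_inverse_word w by blast
  have "g \<otimes> h \<otimes> inv h = g"
    using assms ball_gens_closed by (simp add: m_assoc)
  then show "length (sl g) \<le> length (sl (g \<otimes> h)) + K"
    using length_sl_mult_le[of "g \<otimes> h" w'] assms ball_gens_closed w w' by simp
qed

text \<open>A candidate for the cone in which \<open>g\<close> does not occur: all dependence on
  \<open>g\<close> has to pass through \<open>\<Phi>\<close>.\<close>

definition cone_of :: "nat \<Rightarrow> ('a \<Rightarrow> ('a list \<times> 'a list) set) \<Rightarrow> 'a list set" where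
  "cone_of K \<Phi> = {u \<in> words.
    \<not> (\<exists>h \<in> ball_gens K. \<exists>a \<in> words. h \<otimes> word_val G a = word_val G u \<and> (a, u) \<in> \<Phi> h)}"

text \<open>The restriction to the ball fixes the values elsewhere, so that the types lie in a
  \<open>PiE\<close> over a finite set and can be counted.\<close>

definition ball_type :: "nat \<Rightarrow> 'a \<Rightarrow> 'a \<Rightarrow> ('a list \<times> 'a list) set" where
  "ball_type K g = (\<lambda>h \<in> ball_gens K. shortlex_extensions r (sl (g \<otimes> h)) (sl g))"

lemma finite_ball_types: "finite (ball_type K ` carrier G)"
proof -
  let ?E = "{shortlex_extensions r x y | x y.
    x \<in> words \<and> y \<in> words \<and> length x \<le> length y + K \<and> length y \<le> length x + K}"
  have "shortlex_extensions r (sl (g \<otimes> h)) (sl g) \<in> ?E"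
    if "g \<in> carrier G" "h \<in> ball_gens K" for g h
    using length_sl_ball[OF that] that ball_gens_closed sl_words m_closed by blast
  then have "ball_type K ` carrier G \<subseteq> PiE (ball_gens K) (\<lambda>_. ?E)"
    unfolding ball_type_def by (intro image_subsetI) (simp only: restrict_PiE_iff, blast)
  moreover have "finite (PiE (ball_gens K) (\<lambda>_. ?E))"
    by (intro finite_PiE finite_ball_gens finite_shortlex_extensions irrefl_r finite_letters)
  ultimately show ?thesis
    by (rule finite_subset)
qed

section \<open>From fellow travelling to cones\<close>

lemma SL_FFTP_vertex:
  assumes "SL_FFTP G \<Sigma> r"
  obtains K where "\<And>w x y. w \<in> words \<Longrightarrow> w \<notin> SL_words G \<Sigma> r \<Longrightarrow> w = x @ y \<Longrightarrow>
    \<exists>p \<in> words. \<exists>q \<in> words. \<exists>h \<in> ball_gens K. word_val G p = word_val G x \<otimes> h \<and>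
      word_val G (p @ q) = word_val G w \<and> p @ q \<prec> w"
proof -
  obtain K :: real where K: "K \<ge> 0" "\<And>w. w \<in> words \<Longrightarrow> w \<notin> SL_words G \<Sigma> r \<Longrightarrow>
    \<exists>v \<in> words. words_async_fellow_travel G \<Sigma> K w v \<and> word_val G w = word_val G v \<and> v \<prec> w"
    using assms unfolding SL_FFTP_def by blast
  show thesis
  proof (rule that)
    fix w x y
    assume w: "w \<in> words" "w \<notin> SL_words G \<Sigma> r" and wxy: "w = x @ y"
    obtain v where v: "v \<in> words" "words_async_fellow_travel G \<Sigma> K w v"
      "word_val G w = word_val G v" "v \<prec> w"
      using K(2)[OF w] by blast
    have nth: "word_path G u ! i = word_val G (take i u)" if "i < Suc (length u)" for u i
      using that by (simp add: word_path_def del: upt_Suc)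
    have len: "length (word_path G u) = Suc (length u)" for u
      by (simp add: word_path_def)
    obtain f where f: "f ` {..<Suc (length w)} \<subseteq> {..<Suc (length v)}"
      "\<forall>i < Suc (length w). real (cayley_dist G \<Sigma> (word_path G w ! i) (word_path G v ! f i)) \<le> K"
      using v(2) unfolding words_async_fellow_travel_def paths_async_fellow_travel_def len by blast
    \<comment> \<open>The vertex that \<open>w\<close> reaches after \<open>x\<close> is matched
      with the vertex of \<open>v\<close> at index \<open>f (length x)\<close>; \<open>v\<close> is
      cut there.\<close>
    define p where "p = take (f (length x)) v"
    define q where "q = drop (f (length x)) v"
    have pq: "v = p @ q" "p \<in> words" "q \<in> words"
      using v(1) unfolding p_def q_def by (auto dest: in_set_takeD in_set_dropD)
    \<comment> \<open>A path has one vertex more than its word has letters, so this index is legal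
      even if \<open>y\<close> is empty.\<close>
    have i: "length x < Suc (length w)"
      by (simp add: wxy)
    then have fi: "f (length x) < Suc (length v)"
      using f(1) by blast
    have d: "real (cayley_dist G \<Sigma> (word_val G x) (word_val G p)) \<le> K"
      using f(2)[rule_format, OF i] nth[OF i] nth[OF fi] by (simp add: wxy p_def)
    have "word_val G x \<in> carrier G" "word_val G p \<in> carrier G"
      using w(1) wxy pq by auto
    then obtain a where a: "a \<in> words" "length a = cayley_dist G \<Sigma> (word_val G x) (word_val G p)"
      "word_val G p = word_val G x \<otimes> word_val G a"
      using cayley_dist_word by blast
    \<comment> \<open>Distances are natural numbers, so the real constant may be rounded
      down.\<close>
    have "length a \<le> nat \<lfloor>K\<rfloor>"
      using d K(1) a(2) by linarith
    then have "word_val G a \<in> ball_gens (nat \<lfloor>K\<rfloor>)"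
      using a(1) by (auto simp: ball_gens_def)
    then show "\<exists>p \<in> words. \<exists>q \<in> words. \<exists>h \<in> ball_gens (nat \<lfloor>K\<rfloor>).
      word_val G p = word_val G x \<otimes> h \<and> word_val G (p @ q) = word_val G w \<and> p @ q \<prec> w"
      using pq v a by metis
  qed
qed

lemma SL_cone_eq_cone_of:
  assumes "SL_FFTP G \<Sigma> r"
  obtains K where "\<And>g. g \<in> carrier G \<Longrightarrow> SL_cone G \<Sigma> r g = cone_of K (ball_type K g)"
proof -
  obtain K where K: "\<And>w x y. w \<in> words \<Longrightarrow> w \<notin> SL_words G \<Sigma> r \<Longrightarrow> w = x @ y \<Longrightarrow>
    \<exists>p \<in> words. \<exists>q \<in> words. \<exists>h \<in> ball_gens K. word_val G p = word_val G x \<otimes> h \<and>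
      word_val G (p @ q) = word_val G w \<and> p @ q \<prec> w"
    using SL_FFTP_vertex[OF assms] by blast
  show thesis
  proof (rule that)
    fix g
    assume g: "g \<in> carrier G"
    have "sl g @ u \<notin> SL_words G \<Sigma> r \<longleftrightarrow>
        (\<exists>h \<in> ball_gens K. \<exists>a \<in> words. h \<otimes> word_val G a = word_val G u \<and> sl (g \<otimes> h) @ a \<prec> sl g @ u)"
      (is "?L \<longleftrightarrow> ?R") if u: "u \<in> words" for u
    proof
      assume ?L
      moreover have gu: "sl g @ u \<in> words" "word_val G (sl g @ u) = g \<otimes> word_val G u"
        using g u by (auto simp: sl_words word_val_sl word_val_append)
      ultimately obtain p q h where pq: "p \<in> words" "q \<in> words" "h \<in> ball_gens K"
        "word_val G p = g \<otimes> h" "word_val G (p @ q) = g \<otimes> word_val G u" "p @ q \<prec> sl g @ u"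
        using K[of "sl g @ u" "sl g" u] g by (auto simp: word_val_sl)
      have h: "h \<in> carrier G"
        using pq(3) by (rule ball_gens_closed)
      \<comment> \<open>Cancelling \<open>g\<close> on the left leaves a condition on
        \<open>h\<close>, \<open>q\<close> and \<open>u\<close> alone, as \<open>cone_of\<close>
        requires.\<close>
      have "g \<otimes> (h \<otimes> word_val G q) = g \<otimes> word_val G u"
        using pq g h by (simp add: word_val_append m_assoc)
      then have "h \<otimes> word_val G q = word_val G u"
        using g h pq(2) u by simp
      \<comment> \<open>\<open>p\<close> represents \<open>g \<otimes> h\<close>, so its shortlex
        representative is \<open>p\<close> or smaller, and appending \<open>q\<close> to both
        preserves this.\<close>
      moreover have "sl (g \<otimes> h) @ q \<prec> sl g @ u"
        using sl_eq_or_less[OF pq(1)] pq(4,6) lenlex_append1[of "sl (g \<otimes> h)" p r q q] trans_lenlex_r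
        by (auto dest: transD)
      ultimately show ?R
        using pq(2,3) by blast
    next
      assume ?R
      then obtain h a where *: "h \<in> ball_gens K" "a \<in> words" "h \<otimes> word_val G a = word_val G u"
        "sl (g \<otimes> h) @ a \<prec> sl g @ u"
        by blast
      have h: "h \<in> carrier G"
        using *(1) by (rule ball_gens_closed)
      \<comment> \<open>Both words represent the same element, so the smaller one rules out
        minimality of \<open>sl g @ u\<close>.\<close>
      have "word_val G (sl (g \<otimes> h) @ a) = word_val G (sl g @ u)"
        using * h g u by (simp add: word_val_append sl_words word_val_sl m_assoc)
      then show ?L
        using SL_words_iff[of "sl g @ u"] * h g u sl_words by (metis append_in_lists_conv m_closed)
    qed
    then show "SL_cone G \<Sigma> r g = cone_of K (ball_type K g)"
      unfolding SL_cone_def cone_of_def ball_type_def shortlex_extensions_def by auto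
  qed
qed

end

theorem proposition3p6:
  fixes G :: "('a, 'b) monoid_scheme" and \<Sigma> :: "'a set" and r :: "('a \<times> 'a) set"
  assumes "group G"
    and "finite \<Sigma>" and "\<Sigma> \<subseteq> carrier G" and "generate G \<Sigma> = carrier G"
    and "r \<subseteq> letters G \<Sigma> \<times> letters G \<Sigma>" and "strict_linear_order_on (letters G \<Sigma>) r"
    and "SL_FFTP G \<Sigma> r"
  shows "finite {SL_cone G \<Sigma> r g | g. g \<in> carrier G}"
proof -
  interpret ordered_generators G \<Sigma> r
    using assms by (simp add: ordered_generators_def ordered_generators_axioms_def)
  obtain K where K: "\<And>g. g \<in> carrier G \<Longrightarrow> SL_cone G \<Sigma> r g = cone_of K (ball_type K g)"
    using SL_cone_eq_cone_of[OF assms(7)] by blast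
  then have "{SL_cone G \<Sigma> r g | g. g \<in> carrier G} = cone_of K ` ball_type K ` carrier G"
    by force
  then show ?thesis
    using finite_ball_types by simp
qed

end
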